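(* Let $E$ be a (real) Banach lattice and let $k, m$ be positive integers with $k<m$. Let $\lambda_1,\lambda_2,\ldots,\lambda_k$ be non-zero real scalars and let $\varphi_1,\varphi_2,\ldots,\varphi_k$ be pairwise independent continuous linear functionals on $E$ (that is, $\varphi_i\neq\lambda\varphi_j$ for all $i\neq j$ and all $\lambda\in\mathbb{R}$). Then the $m$-homogeneous polynomial $P=\sum_{j=1}^k\lambda_j\varphi_j^m$ is orthogonally additive if and only if, for each $j$ with $1\le j\le k$, $\varphi_j$ or $-\varphi_j$ is a lattice homomorphism.
   Context: All spaces are over $\mathbb{R}$. An $m$-homogeneous polynomial on a Banach space $E$ is a map $P\colon E\to\mathbb{R}$ of the form $P(x)=A(x,\dots,x)$, where $A\colon E^m\to\mathbb{R}$ is a bounded symmetric $m$-linear map. Here $\varphi_j^m$ denotes the $m$-homogeneous polynomial $x\mapsto \varphi_j(x)^m$. An $m$-homogeneous polynomial $P$ on a Banach lattice $E$ is orthogonally additive if $P(x+y)=P(x)+P(y)$ whenever $|x|\wedge|y|=0$. A bounded linear operator $T\colon E\to F$ between Banach lattices is a lattice homomorphism if $T(x\vee y)=(Tx)\vee(Ty)$ and $T(x\wedge y)=(Tx)\wedge(Ty)$ for all $x,y\in E$; for functionals, $F=\mathbb{R}$ with its usual order. *)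

theory Defs
  imports "HOL-Analysis.Analysis" "HOL-Library.Lattice_Algebras"
begin

text \<open>Real Banach lattices. The modulus is the lattice-theoretic one,
  \<open>\<bar>x\<bar> = sup x (- x)\<close>, inherited from \<open>lattice_ab_group_add_abs\<close>.\<close>

class banach_lattice = banach + ordered_real_vector + lattice_ab_group_add_abs +
  assumes norm_mono_abs: "\<bar>x\<bar> \<le> \<bar>y\<bar> \<Longrightarrow> norm x \<le> norm y"

instance real :: banach_lattice
  by standard simp

definition lattice_homomorphism ::
    "('a::banach_lattice \<Rightarrow>\<^sub>L 'b::banach_lattice) \<Rightarrow> bool" where
  "lattice_homomorphism T \<longleftrightarrow>
    (\<forall>x y. blinfun_apply T (sup x y) = sup (blinfun_apply T x) (blinfun_apply T y) \<and>
           blinfun_apply T (inf x y) = inf (blinfun_apply T x) (blinfun_apply T y))"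

text \<open>A map \<open>E\<^sup>m \<rightarrow> \<real>\<close> is represented by a map on sequences that depends only on the
  entries with index \<open>i < m\<close>. Without this first clause \<open>A (\<lambda>_. x)\<close> below could depend on
  \<open>x\<close> through the irrelevant entries.\<close>

definition bounded_symmetric_multilinear ::
    "nat \<Rightarrow> ((nat \<Rightarrow> 'a::real_normed_vector) \<Rightarrow> real) \<Rightarrow> bool" where
  "bounded_symmetric_multilinear m A \<longleftrightarrow>
    (\<forall>v w. (\<forall>i<m. v i = w i) \<longrightarrow> A v = A w) \<and>
    (\<forall>v. \<forall>i<m. linear (\<lambda>x. A (v(i := x)))) \<and>
    (\<forall>v p. p permutes {..<m} \<longrightarrow> A (\<lambda>i. v (p i)) = A v) \<and>
    (\<exists>K. \<forall>v. \<bar>A v\<bar> \<le> K * (\<Prod>i<m. norm (v i)))"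

definition homogeneous_polynomial ::
    "nat \<Rightarrow> ('a::real_normed_vector \<Rightarrow> real) \<Rightarrow> bool" where
  "homogeneous_polynomial m P \<longleftrightarrow>
    (\<exists>A. bounded_symmetric_multilinear m A \<and> (\<forall>x. P x = A (\<lambda>_. x)))"

definition orthogonally_additive_polynomial ::
    "nat \<Rightarrow> ('a::banach_lattice \<Rightarrow> real) \<Rightarrow> bool" where
  "orthogonally_additive_polynomial m P \<longleftrightarrow>
    homogeneous_polynomial m P \<and>
    (\<forall>x y. inf \<bar>x\<bar> \<bar>y\<bar> = 0 \<longrightarrow> P (x + y) = P x + P y)"

text \<open>Finite combinations of powers of functionals are homogeneous polynomials, so for them the
  first conjunct of \<open>orthogonally_additive_polynomial\<close> always holds.\<close>

lemma homogeneous_polynomial_sum_powers: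
  fixes \<phi> :: "nat \<Rightarrow> ('a::real_normed_vector \<Rightarrow>\<^sub>L real)" and c :: "nat \<Rightarrow> real"
  shows "homogeneous_polynomial m (\<lambda>x. \<Sum>j=1..k. c j * blinfun_apply (\<phi> j) x ^ m)"
proof -
  define A where "A v = (\<Sum>j=1..k. c j * (\<Prod>i<m. blinfun_apply (\<phi> j) (v i)))" for v
  have "A v = A w" if "\<forall>i<m. v i = w i" for v w
    using that by (simp add: A_def)
  moreover have "linear (\<lambda>x. A (v(i := x)))" if "i < m" for v i
  proof -
    have eq: "A (v(i := x)) = (\<Sum>j=1..k. c j * (\<Prod>l\<in>{..<m} - {i}. blinfun_apply (\<phi> j) (v l))
        * blinfun_apply (\<phi> j) x)" for x
      unfolding A_def using that
      by (intro sum.cong refl) (simp add: prod.remove[of "{..<m}" i])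
    show ?thesis
      unfolding eq
      by (rule linearI)
        (simp_all add: blinfun.add_right blinfun.scaleR_right distrib_left sum.distrib
          sum_distrib_left mult.assoc mult.left_commute)
  qed
  moreover have "A (\<lambda>i. v (p i)) = A v" if "p permutes {..<m}" for v p
    unfolding A_def
    using prod.permute[OF that, of "\<lambda>i. blinfun_apply (\<phi> j) (v i)" for j]
    by (simp add: o_def)
  moreover have "\<bar>A v\<bar> \<le> (\<Sum>j=1..k. \<bar>c j\<bar> * norm (\<phi> j) ^ m) * (\<Prod>i<m. norm (v i))" for v
  proof -
    have "\<bar>A v\<bar> \<le> (\<Sum>j=1..k. \<bar>c j\<bar> * (\<Prod>i<m. \<bar>blinfun_apply (\<phi> j) (v i)\<bar>))"
      unfolding A_def by (rule order_trans[OF sum_abs]) (simp add: abs_mult abs_prod)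
    also have "\<dots> \<le> (\<Sum>j=1..k. \<bar>c j\<bar> * (\<Prod>i<m. norm (\<phi> j) * norm (v i)))"
      by (intro sum_mono mult_left_mono prod_mono) (simp_all flip: real_norm_def add: norm_blinfun)
    finally show ?thesis
      by (simp add: prod.distrib sum_distrib_right mult.assoc)
  qed
  ultimately have "bounded_symmetric_multilinear m A"
    unfolding bounded_symmetric_multilinear_def by blast
  moreover have "(\<Sum>j=1..k. c j * blinfun_apply (\<phi> j) x ^ m) = A (\<lambda>_. x)" for x
    by (simp add: A_def)
  ultimately show ?thesis
    unfolding homogeneous_polynomial_def by blast
qed

end

theory Submission
  imports Defs
begin

text \<open>
  Let \<open>P = \<Sum>\<^sub>j c\<^sub>j \<phi>\<^sub>j\<^sup>m\<close>. If each \<open>\<phi>\<^sub>j\<close> is a lattice homomorphism up to sign, then on a disjoint pair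
  \<open>x, y\<close> each \<open>\<phi>\<^sub>j\<close> vanishes at \<open>x\<close> or at \<open>y\<close>, so that \<open>\<phi>\<^sub>j (x + y)\<^sup>m\<close> splits and \<open>P\<close> is
  orthogonally additive.

  The converse rests on three ideas.

  \<^item> The symmetric multilinear form of an orthogonally additive polynomial vanishes as soon as
    two of its arguments are disjoint, whatever the other arguments are
    (\<open>mixed_sum_eq_0\<close>). When every argument belongs to one of two disjoint groups this is just
    comparison of coefficients in \<open>P (u + t v) = P u + t\<^sup>m P v\<close>. A further argument \<open>w \<ge> 0\<close> is
    removed by cutting it into \<open>w \<sqinter> N u\<close>, which is disjoint from \<open>v\<close>, and \<open>(w - N u)\<^sup>+\<close>, which is
    disjoint from the slightly smaller element \<open>(u - w/N)\<^sup>+\<close>; each piece can join one of the two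
    groups, and the error made by shrinking \<open>u\<close> disappears as \<open>N\<close> grows. This replaces
    the decomposition of \<open>w\<close> by band projections, which need not exist.

  \<^item> Hence \<open>\<Sum>\<^sub>j c\<^sub>j \<phi>\<^sub>j(u) \<phi>\<^sub>j(v) \<phi>\<^sub>j(w)\<^bsup>m-2\<^esup> = 0\<close> for disjoint \<open>u, v \<ge> 0\<close> and every \<open>w \<ge> 0\<close>. The
    powers of exponent \<open>m - 2\<close> of at most \<open>m - 1\<close> pairwise independent functionals are
    linearly independent, even on the positive cone (\<open>powers_independent_on_cone\<close>). This is where
    \<open>k < m\<close> enters, and it yields \<open>\<phi>\<^sub>j(u) \<phi>\<^sub>j(v) = 0\<close> for each single \<open>j\<close>.

  \<^item> A bounded functional with this property has constant sign on the positive cone and is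
    therefore a lattice homomorphism up to sign
    (\<open>disjointness_preserving_functional_is_signed_homomorphism\<close>).
\<close>

section \<open>Disjoint elements and positive parts\<close>

lemma inf_plus_pos_part_diff:
  fixes w x :: "'a::lattice_ab_group_add"
  shows "inf w x + sup (w - x) 0 = w"
proof -
  have "sup (w - x) 0 = sup w x - x"
    using add_sup_distrib_right[of w x "- x"] by simp
  then have "inf w x + sup (w - x) 0 = (sup w x + inf w x) - x"
    by (simp only: add_diff_eq add.commute)
  then show ?thesis
    by (simp flip: add_eq_inf_sup)
qed

lemma inf_pos_part_neg_part:
  fixes x :: "'a::lattice_ab_group_add"
  shows "inf (sup x 0) (sup (- x) 0) = 0"
proof -
  have "sup x 0 = x + sup (- x) 0"
    by (simp add: add_sup_distrib_left sup_commute)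
  then have "inf (sup x 0) (sup (- x) 0) = inf x 0 + sup (- x) 0"
    by (simp add: add_inf_distrib_right)
  also have "\<dots> = 0"
    using neg_inf_eq_sup[of x 0] by (metis add.right_inverse minus_zero)
  finally show ?thesis .
qed

lemma pos_part_minus_neg_part:
  fixes x :: "'a::lattice_ab_group_add"
  shows "sup x 0 - sup (- x) 0 = x"
proof -
  have "x + sup (- x) 0 = sup x 0"
    by (simp add: add_sup_distrib_left sup_commute)
  then show ?thesis by (simp only: diff_eq_eq)
qed

lemma inf_add_eq_0:
  fixes u :: "'a::lattice_ab_group_add"
  assumes "0 \<le> u" "0 \<le> x" "0 \<le> y" "inf u x = 0" "inf u y = 0"
  shows "inf u (x + y) = 0"
proof (rule antisym)
  let ?z = "inf u (x + y)"
  have "?z - x \<le> inf u y"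
    using assms(2) by (auto simp: diff_le_eq add.commute intro: le_infI1 le_infI2 add_increasing)
  then have "?z \<le> inf u x"
    using assms(5) by simp
  then show "?z \<le> 0" using assms(4) by simp
  show "0 \<le> ?z" using assms by simp
qed

text \<open>With \<open>r = max 1 t\<close> the infimum lies below \<open>r u\<close> and \<open>r v\<close>; dividing by \<open>r\<close> puts it below
  \<open>u \<sqinter> v\<close>.\<close>

lemma inf_scaleR_eq_0:
  fixes u v :: "'a::banach_lattice"
  assumes "0 \<le> u" "0 \<le> v" "inf u v = 0" "0 \<le> t"
  shows "inf u (t *\<^sub>R v) = 0"
proof (rule antisym)
  let ?r = "max 1 t" and ?z = "inf u (t *\<^sub>R v)"
  have "?z \<le> ?r *\<^sub>R u"
    using scaleR_right_mono[of 1 ?r u] assms(1) by (auto intro: le_infI1)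
  moreover have "?z \<le> ?r *\<^sub>R v"
    using scaleR_right_mono[of t ?r v] assms(2) by (auto intro: le_infI2)
  moreover have "0 < ?r" by simp
  ultimately have "?z /\<^sub>R ?r \<le> inf u v"
    by (simp only: le_inf_iff pos_divideR_le_eq)
  then have "?z /\<^sub>R ?r \<le> 0"
    using assms(3) by simp
  then show "?z \<le> 0"
    using \<open>0 < ?r\<close> by (simp only: pos_divideR_le_eq scaleR_zero_right)
  show "0 \<le> ?z" using assms by (simp add: scaleR_nonneg_nonneg)
qed

lemma inf_mono_eq_0:
  fixes u v :: "'a::lattice_ab_group_add"
  assumes "0 \<le> x" "x \<le> u" "0 \<le> y" "y \<le> v" "inf u v = 0"
  shows "inf x y = 0"
  using assms inf_mono[of x u y v] by (intro antisym) auto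

text \<open>Taking positive parts is a contraction because \<open>x\<^sup>+ \<le> y\<^sup>+ + \<bar>x - y\<bar>\<close>. Its continuity serves twice:
  to pass to the limit in the approximation \<open>(u - w/N)\<^sup>+ \<longlonglongrightarrow> u\<close>, and to apply the intermediate
  value theorem along a segment.\<close>

lemma norm_pos_part_diff_le:
  fixes x y :: "'a::banach_lattice"
  shows "norm (sup x 0 - sup y 0) \<le> norm (x - y)"
proof (rule norm_mono_abs)
  have *: "sup a 0 \<le> sup b 0 + \<bar>a - b\<bar>" for a b :: 'a
  proof (rule sup_least)
    have "a = b + (a - b)" by simp
    also have "\<dots> \<le> sup b 0 + \<bar>a - b\<bar>"
      by (intro add_mono abs_ge_self) simp
    finally show "a \<le> sup b 0 + \<bar>a - b\<bar>" .
  qed simp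
  show "\<bar>sup x 0 - sup y 0\<bar> \<le> \<bar>x - y\<bar>"
    using *[of x y] *[of y x] by (intro abs_leI) (simp_all only: minus_diff_eq diff_le_eq add.commute abs_minus_commute)
qed

lemma tendsto_pos_part:
  fixes f :: "'b \<Rightarrow> 'a::banach_lattice"
  assumes "(f \<longlongrightarrow> l) F"
  shows "((\<lambda>x. sup (f x) 0) \<longlongrightarrow> sup l 0) F"
proof (rule LIM_zero_cancel, rule Lim_null_comparison)
  show "\<forall>\<^sub>F x in F. norm (sup (f x) 0 - sup l 0) \<le> norm (f x - l)"
    by (intro always_eventually allI norm_pos_part_diff_le)
  show "((\<lambda>x. norm (f x - l)) \<longlongrightarrow> 0) F"
    using assms by (intro tendsto_norm_zero LIM_zero)
qed

lemma continuous_on_pos_part [continuous_intros]: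
  fixes f :: "'b::topological_space \<Rightarrow> 'a::banach_lattice"
  assumes "continuous_on S f"
  shows "continuous_on S (\<lambda>x. sup (f x) 0)"
  using assms unfolding continuous_on_def by (auto intro: tendsto_pos_part)

section \<open>Functionals that annihilate one of any two disjoint elements\<close>

text \<open>If \<open>\<phi>\<close> took a positive value at \<open>p \<ge> 0\<close> and a negative one at \<open>q \<ge> 0\<close>, then \<open>\<phi>\<close> would be at least
  some \<open>\<mu> > 0\<close> on the segment from \<open>p\<close> to \<open>- q\<close>. At each point \<open>x\<close> of it one of \<open>\<phi> (x\<^sup>+)\<close>, \<open>\<phi> (x\<^sup>-)\<close>
  vanishes, so \<open>\<phi> (x\<^sup>+)\<close> is either \<open>0\<close> or at least \<open>\<mu>\<close>; but it moves continuously from \<open>\<phi> p \<ge> \<mu>\<close> to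
  \<open>0\<close>. So \<open>\<phi>\<close> or \<open>- \<phi>\<close> is positive, and a positive functional that vanishes at \<open>x\<^sup>+\<close> or \<open>x\<^sup>-\<close>
  commutes with positive parts, from which suprema and infima are recovered by translation.\<close>

lemma disjointness_preserving_functional_is_signed_homomorphism:
  fixes \<phi> :: "'a::banach_lattice \<Rightarrow>\<^sub>L real"
  assumes disj: "\<And>u v. 0 \<le> u \<Longrightarrow> 0 \<le> v \<Longrightarrow> inf u v = 0 \<Longrightarrow> \<phi> u * \<phi> v = 0"
  shows "lattice_homomorphism \<phi> \<or> lattice_homomorphism (- \<phi>)"
proof -
  have parts: "\<phi> (sup x 0) * \<phi> (sup (- x) 0) = 0" for x
    by (rule disj) (simp_all add: inf_pos_part_neg_part)
  have decomp: "\<phi> x = \<phi> (sup x 0) - \<phi> (sup (- x) 0)" for x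
    by (simp only: pos_part_minus_neg_part flip: blinfun.diff_right)
  have hom: "lattice_homomorphism \<psi>"
    if pos: "\<And>x. 0 \<le> x \<Longrightarrow> 0 \<le> \<psi> x" and parts: "\<And>x. \<psi> (sup x 0) * \<psi> (sup (- x) 0) = 0" 
      and decomp: "\<And>x. \<psi> x = \<psi> (sup x 0) - \<psi> (sup (- x) 0)"
    for \<psi> :: "'a \<Rightarrow>\<^sub>L real"
  proof -
    have pp: "\<psi> (sup x 0) = sup (\<psi> x) 0" for x
      using parts[of x] decomp[of x] pos[of "sup x 0"] pos[of "sup (- x) 0"]
      by (auto simp: sup_real_def max_def)
    have s: "\<psi> (sup x y) = sup (\<psi> x) (\<psi> y)" for x y
    proof -
      have "sup x y = y + sup (x - y) 0"
        by (simp add: add_sup_distrib_left)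
      then show ?thesis
        using pp[of "x - y"] by (simp add: blinfun.add_right blinfun.diff_right sup_real_def max_def)
    qed
    have i: "\<psi> (inf x y) = inf (\<psi> x) (\<psi> y)" for x y
    proof -
      have "inf x y = x - sup (x - y) 0"
        using inf_plus_pos_part_diff[of x y] by (simp only: eq_diff_eq)
      then show ?thesis
        using pp[of "x - y"] by (simp only: blinfun.diff_right sup_real_def inf_real_def)
    qed
    show ?thesis unfolding lattice_homomorphism_def using s i by blast
  qed
  have "(\<forall>x\<ge>0. 0 \<le> \<phi> x) \<or> (\<forall>x\<ge>0. \<phi> x \<le> 0)"
  proof (rule ccontr)
    assume "\<not> ?thesis"
    then obtain p q where pq: "0 \<le> p" "0 \<le> q" "0 < \<phi> p" "\<phi> q < 0"
      by (auto simp: not_le)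
    define h where "h s = (1 - s) *\<^sub>R p - s *\<^sub>R q" for s :: real
    define \<mu> where "\<mu> = min (\<phi> p) (- \<phi> q)"
    have "0 < \<mu>" "\<mu> \<le> \<phi> p" "\<mu> \<le> - \<phi> q" using pq by (auto simp: \<mu>_def)
    have low: "\<mu> \<le> \<phi> (h s)" if "0 \<le> s" "s \<le> 1" for s
    proof -
      have "\<mu> = (1 - s) * \<mu> + s * \<mu>" by (simp add: algebra_simps)
      also have "\<dots> \<le> (1 - s) * \<phi> p + s * (- \<phi> q)"
        using that \<open>\<mu> \<le> \<phi> p\<close> \<open>\<mu> \<le> - \<phi> q\<close> by (intro add_mono mult_left_mono) auto
      also have "\<dots> = \<phi> (h s)"
        by (simp add: h_def blinfun.diff_right blinfun.scaleR_right)
      finally show ?thesis .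
    qed
    have "continuous_on {0..1} (\<lambda>s. \<phi> (sup (h s) 0))"
      unfolding h_def by (intro continuous_intros)
    moreover have "sup (h 1) 0 = 0" "sup (h 0) 0 = p"
      using pq by (simp_all add: h_def sup.absorb1 sup.absorb2)
    ultimately obtain s where s: "0 \<le> s" "s \<le> 1" "\<phi> (sup (h s) 0) = \<mu> / 2"
      using IVT2'[of "\<lambda>s. \<phi> (sup (h s) 0)" 1 "\<mu> / 2" 0] \<open>0 < \<mu>\<close> \<open>\<mu> \<le> \<phi> p\<close> by (auto simp: blinfun.zero_right)
    then have "\<phi> (h s) = \<mu> / 2"
      using parts[of "h s"] decomp[of "h s"] \<open>0 < \<mu>\<close> by simp
    then show False using low[of s] s \<open>0 < \<mu>\<close> by simp
  qed
  then show ?thesis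
  proof
    assume "\<forall>x\<ge>0. 0 \<le> \<phi> x"
    then show ?thesis using hom[of \<phi>] parts decomp by blast
  next
    assume "\<forall>x\<ge>0. \<phi> x \<le> 0"
    then have "lattice_homomorphism (- \<phi>)"
    proof (intro hom)
      show "(- \<phi>) (sup x 0) * (- \<phi>) (sup (- x) 0) = 0" for x
        using parts[of x] by (simp only: blinfun.minus_left minus_mult_minus)
      show "(- \<phi>) x = (- \<phi>) (sup x 0) - (- \<phi>) (sup (- x) 0)" for x
        using decomp[of x] by (simp only: blinfun.minus_left)
    qed (simp add: blinfun.minus_left)
    then show ?thesis ..
  qed
qed

lemma lattice_homomorphism_disjoint:
  fixes \<phi> :: "'a::banach_lattice \<Rightarrow>\<^sub>L real"
  assumes "lattice_homomorphism \<phi> \<or> lattice_homomorphism (- \<phi>)" "inf \<bar>x\<bar> \<bar>y\<bar> = 0"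
  shows "\<phi> x = 0 \<or> \<phi> y = 0"
proof -
  have *: "\<psi> x = 0 \<or> \<psi> y = 0" if "lattice_homomorphism \<psi>" for \<psi> :: "'a \<Rightarrow>\<^sub>L real"
  proof -
    have abs: "\<psi> \<bar>z\<bar> = \<bar>\<psi> z\<bar>" for z
      using that by (simp add: lattice_homomorphism_def abs_lattice blinfun.minus_right)
    have "inf \<bar>\<psi> x\<bar> \<bar>\<psi> y\<bar> = \<psi> (inf \<bar>x\<bar> \<bar>y\<bar>)"
      using that by (simp add: lattice_homomorphism_def abs)
    then show ?thesis
      using assms(2) by (auto simp: blinfun.zero_right inf_real_def min_def split: if_splits)
  qed
  show ?thesis
    using assms(1) *[of \<phi>] *[of "- \<phi>"] by (auto simp: blinfun.minus_left)
qed

section \<open>Comparing coefficients\<close>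

text \<open>Only positive \<open>t\<close> are tested, since \<open>u + t v\<close> has to remain in the positive cone; infinitely
  many values of \<open>t\<close> still determine a polynomial.\<close>

lemma power_sum_coeff:
  fixes d \<alpha> \<beta> :: "'i \<Rightarrow> real" and r :: "nat \<Rightarrow> real"
  assumes eq: "\<And>t. 0 < t \<Longrightarrow> (\<Sum>j\<in>S. d j * (\<alpha> j + t * \<beta> j) ^ n) = (\<Sum>i\<le>n. r i * t ^ i)"
    and "i \<le> n"
  shows "real (n choose i) * (\<Sum>j\<in>S. d j * \<alpha> j ^ (n - i) * \<beta> j ^ i) = r i"
proof -
  define a where "a i = real (n choose i) * (\<Sum>j\<in>S. d j * \<alpha> j ^ (n - i) * \<beta> j ^ i)" for i
  have "(\<Sum>i\<le>n. a i * t ^ i) = (\<Sum>j\<in>S. d j * (\<alpha> j + t * \<beta> j) ^ n)" for t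
  proof -
    have "(\<Sum>j\<in>S. d j * (\<alpha> j + t * \<beta> j) ^ n)
        = (\<Sum>j\<in>S. \<Sum>i\<le>n. real (n choose i) * (d j * \<alpha> j ^ (n - i) * \<beta> j ^ i) * t ^ i)"
      by (subst add.commute)
        (simp add: binomial_ring sum_distrib_left power_mult_distrib mult_ac)
    also have "\<dots> = (\<Sum>i\<le>n. a i * t ^ i)"
      by (subst sum.swap) (simp add: a_def sum_distrib_left sum_distrib_right mult.assoc)
    finally show ?thesis by simp
  qed
  then have "(\<Sum>i\<le>n. (a i - r i) * t ^ i) = 0" if "0 < t" for t
    using eq[OF that] by (simp add: left_diff_distrib sum_subtractf)
  then have "{0<..} \<subseteq> {t. (\<Sum>i\<le>n. (a i - r i) * t ^ i) = 0}" by auto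
  then have "infinite {t. (\<Sum>i\<le>n. (a i - r i) * t ^ i) = 0}"
    using infinite_Ioi finite_subset by blast
  then have "a i - r i = 0"
    using polyfun_finite_roots[of "\<lambda>i. a i - r i" n] \<open>i \<le> n\<close> by blast
  then show ?thesis by (simp add: a_def)
qed

text \<open>The coefficient of \<open>t\<close> alone: it turns one of \<open>n + 1\<close> equal arguments \<open>\<alpha>\<close> into \<open>\<beta>\<close>, which is
  the form in which polarisation is used below.\<close>

lemma linear_coeff_eq_0:
  fixes d \<alpha> \<beta> :: "'i \<Rightarrow> real"
  assumes "\<And>t. 0 < t \<Longrightarrow> (\<Sum>j\<in>S. d j * (\<alpha> j + t * \<beta> j) ^ Suc n) = 0"
  shows "(\<Sum>j\<in>S. d j * \<alpha> j ^ n * \<beta> j) = 0"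
  using power_sum_coeff[where S = S and n = "Suc n" and r = "\<lambda>_. 0" and i = 1] assms by simp

section \<open>Orthogonal additivity annihilates mixed terms\<close>

text \<open>The sum is the symmetric multilinear form of the polynomial with \<open>a\<close> arguments \<open>u\<close>, \<open>b\<close>
  arguments \<open>v\<close> and \<open>d\<close> arguments \<open>w\<close>, and the induction is on the number \<open>d\<close> of arguments unrelated
  to the disjoint pair. It must allow all \<open>a, b, u, v\<close>: a piece of \<open>w\<close> is absorbed by raising \<open>a\<close>
  or \<open>b\<close> by one and perturbing \<open>u\<close> or \<open>v\<close> in the direction of that piece.\<close>

lemma mixed_sum_eq_0:
  fixes \<phi> :: "'i \<Rightarrow> 'a::banach_lattice \<Rightarrow>\<^sub>L real" and c :: "'i \<Rightarrow> real"
  assumes add: "\<And>u v. 0 \<le> u \<Longrightarrow> 0 \<le> v \<Longrightarrow> inf u v = 0 \<Longrightarrow>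
      (\<Sum>j\<in>S. c j * \<phi> j (u + v) ^ m) = (\<Sum>j\<in>S. c j * \<phi> j u ^ m) + (\<Sum>j\<in>S. c j * \<phi> j v ^ m)"
    and "0 < a" "0 < b" "a + b + d = m" "0 \<le> u" "0 \<le> v" "inf u v = 0" "0 \<le> w"
  shows "(\<Sum>j\<in>S. c j * \<phi> j u ^ a * \<phi> j v ^ b * \<phi> j w ^ d) = 0"
  using assms(2-)
proof (induction d arbitrary: a b u v)
  case 0
  define C D where "C = (\<Sum>j\<in>S. c j * \<phi> j u ^ m)" and "D = (\<Sum>j\<in>S. c j * \<phi> j v ^ m)"
  define r where "r i = (if i = 0 then C else 0) + (if i = m then D else 0)" for i
  have "(\<Sum>j\<in>S. c j * (\<phi> j u + t * \<phi> j v) ^ m) = (\<Sum>i\<le>m. r i * t ^ i)" if "0 < t" for t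
  proof -
    have "inf u (t *\<^sub>R v) = 0"
      using 0 that by (intro inf_scaleR_eq_0) auto
    then have "(\<Sum>j\<in>S. c j * (\<phi> j u + t * \<phi> j v) ^ m) = C + D * t ^ m"
      using add[of u "t *\<^sub>R v"] 0 that
      by (simp add: C_def D_def blinfun.add_right blinfun.scaleR_right power_mult_distrib
          scaleR_nonneg_nonneg sum_distrib_left mult_ac)
    also have "\<dots> = (\<Sum>i\<le>m. r i * t ^ i)"
      by (simp add: r_def distrib_right sum.distrib if_distrib[of "\<lambda>x. x * _"] cong: if_cong)
    finally show ?thesis .
  qed
  \<comment> \<open>As \<open>0 < b < m\<close>, the right-hand side has no term of degree \<open>b\<close>.\<close>
  from power_sum_coeff[OF this, of b]
  have "real (m choose b) * (\<Sum>j\<in>S. c j * \<phi> j u ^ a * \<phi> j v ^ b) = 0"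
    using 0 by (auto simp: r_def)
  moreover have "m choose b \<noteq> 0" using 0 by simp
  ultimately show ?case by simp
next
  case (Suc d)
  \<comment> \<open>The cut is made at the multiple \<open>Suc N\<close> of \<open>u\<close>, so the factor is never \<open>0\<close> and at least \<open>1\<close>.\<close>
  define u' where "u' N = sup (u - w /\<^sub>R real (Suc N)) 0" for N
  have zero: "(\<Sum>j\<in>S. c j * \<phi> j (u' N) ^ a * \<phi> j v ^ b * \<phi> j w ^ Suc d) = 0" for N
  proof -
    define R where "R = real (Suc N)"
    have "1 \<le> R" "0 < R" by (simp_all add: R_def)
    define p q where "p = inf w (R *\<^sub>R u)" and "q = sup (w - R *\<^sub>R u) 0"
    have pos: "0 \<le> u' N" "0 \<le> p" "0 \<le> q"
      using Suc.prems \<open>0 < R\<close> by (simp_all add: u'_def p_def q_def scaleR_nonneg_nonneg)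
    have "u' N \<le> u"
      using Suc.prems \<open>0 < R\<close> unfolding u'_def R_def[symmetric] by (simp add: scaleR_nonneg_nonneg)
    then have u'v: "inf (u' N) v = 0"
      using Suc.prems pos by (intro inf_mono_eq_0[of "u' N" u v v]) auto
    have "inf (R *\<^sub>R u) v = 0"
      using inf_scaleR_eq_0[of v u R] Suc.prems \<open>0 < R\<close> by (simp add: inf_commute)
    then have pv: "inf p v = 0"
      using Suc.prems pos by (intro inf_mono_eq_0[of p "R *\<^sub>R u" v v]) (auto simp: p_def)
    \<comment> \<open>\<open>u'\<close> is dominated by the negative part of the element whose positive part is \<open>q\<close>.\<close>
    have u'_le: "u' N \<le> sup (- (w - R *\<^sub>R u)) 0"
    proof -
      have "u' N \<le> R *\<^sub>R u' N"
        using scaleR_right_mono[OF \<open>1 \<le> R\<close> pos(1)] by simp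
      also have "R *\<^sub>R u' N \<le> sup (R *\<^sub>R u - w) 0"
      proof -
        have "u - w /\<^sub>R R \<le> sup (R *\<^sub>R u - w) 0 /\<^sub>R R"
          using \<open>0 < R\<close> by (simp add: pos_le_divideR_eq scaleR_diff_right)
        then have "u' N \<le> sup (R *\<^sub>R u - w) 0 /\<^sub>R R"
          using \<open>0 < R\<close> unfolding u'_def R_def[symmetric] by (simp add: scaleR_nonneg_nonneg)
        then show ?thesis
          using \<open>0 < R\<close> by (simp add: pos_le_divideR_eq)
      qed
      finally show ?thesis by simp
    qed
    have u'q: "inf (u' N) q = 0"
      using inf_mono_eq_0[OF pos(1) u'_le pos(3), of q] inf_pos_part_neg_part[of "w - R *\<^sub>R u"]
      by (simp add: q_def inf_commute)
    \<comment> \<open>The piece \<open>q\<close> is disjoint from \<open>u'\<close> and joins \<open>v\<close>.\<close>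
    have "(\<Sum>j\<in>S. c j * \<phi> j (u' N) ^ a * \<phi> j w ^ d * (\<phi> j v + t * \<phi> j q) ^ Suc b) = 0"
      if "0 < t" for t
    proof -
      have "inf (u' N) (v + t *\<^sub>R q) = 0"
        using Suc.prems pos that u'v u'q
        by (intro inf_add_eq_0 inf_scaleR_eq_0) (auto simp: scaleR_nonneg_nonneg)
      then show ?thesis
        using Suc.IH[of a "Suc b" "u' N" "v + t *\<^sub>R q"] Suc.prems pos that
        by (simp add: blinfun.add_right blinfun.scaleR_right scaleR_nonneg_nonneg mult_ac)
    qed
    then have Q: "(\<Sum>j\<in>S. c j * \<phi> j (u' N) ^ a * \<phi> j w ^ d * \<phi> j v ^ b * \<phi> j q) = 0"
      by (rule linear_coeff_eq_0)
    \<comment> \<open>The piece \<open>p\<close> is disjoint from \<open>v\<close> and joins \<open>u'\<close>.\<close>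
    have "(\<Sum>j\<in>S. c j * \<phi> j v ^ b * \<phi> j w ^ d * (\<phi> j (u' N) + t * \<phi> j p) ^ Suc a) = 0"
      if "0 < t" for t
    proof -
      have "inf v (u' N + t *\<^sub>R p) = 0"
        using Suc.prems pos that u'v pv
        by (intro inf_add_eq_0 inf_scaleR_eq_0) (auto simp: scaleR_nonneg_nonneg inf_commute)
      then show ?thesis
        using Suc.IH[of "Suc a" b "u' N + t *\<^sub>R p" v] Suc.prems pos that
        by (simp add: blinfun.add_right blinfun.scaleR_right scaleR_nonneg_nonneg inf_commute mult_ac)
    qed
    then have P: "(\<Sum>j\<in>S. c j * \<phi> j v ^ b * \<phi> j w ^ d * \<phi> j (u' N) ^ a * \<phi> j p) = 0"
      by (rule linear_coeff_eq_0)
    have "\<phi> j w = \<phi> j p + \<phi> j q" for j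
      by (simp add: p_def q_def inf_plus_pos_part_diff flip: blinfun.add_right)
    then have "(\<Sum>j\<in>S. c j * \<phi> j (u' N) ^ a * \<phi> j v ^ b * \<phi> j w ^ Suc d)
      = (\<Sum>j\<in>S. c j * \<phi> j v ^ b * \<phi> j w ^ d * \<phi> j (u' N) ^ a * \<phi> j p)
      + (\<Sum>j\<in>S. c j * \<phi> j (u' N) ^ a * \<phi> j w ^ d * \<phi> j v ^ b * \<phi> j q)"
      by (simp flip: sum.distrib) (simp add: algebra_simps)
    then show ?thesis using P Q by simp
  qed
  have "(\<lambda>N. u - w /\<^sub>R real (Suc N)) \<longlonglongrightarrow> u - 0 *\<^sub>R w"
    using LIMSEQ_inverse_real_of_nat by (intro tendsto_intros)
  then have "u' \<longlonglongrightarrow> sup u 0"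
    unfolding u'_def by (intro tendsto_pos_part) simp
  then have "u' \<longlonglongrightarrow> u"
    using Suc.prems by (simp add: sup.absorb1)
  then have "(\<lambda>N. \<Sum>j\<in>S. c j * \<phi> j (u' N) ^ a * \<phi> j v ^ b * \<phi> j w ^ Suc d)
      \<longlonglongrightarrow> (\<Sum>j\<in>S. c j * \<phi> j u ^ a * \<phi> j v ^ b * \<phi> j w ^ Suc d)"
    by (intro tendsto_intros)
  then show ?case
    using zero by (simp add: LIMSEQ_const_iff)
qed

section \<open>Independence of powers of functionals\<close>

text \<open>Polarise one argument of \<open>\<Sum>\<^sub>i d\<^sub>i \<phi>\<^sub>i\<^sup>n\<close> and evaluate it at a point where \<open>\<phi>\<^sub>i\<close> vanishes and
  \<open>\<phi>\<^sub>j\<close> does not. This removes the index \<open>i\<close>, lowers the exponent by one and multiplies the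
  coefficient \<open>d\<^sub>j\<close> by a non-zero number. With at most \<open>n + 1\<close> functionals, the \<open>n\<close> steps available
  suffice to isolate \<open>j\<close>. Such a point is rarely in the positive cone, but the polarised identity is
  linear in it and so extends from the cone to the whole space.\<close>

lemma powers_independent_on_cone:
  fixes \<phi> :: "'i \<Rightarrow> 'a::banach_lattice \<Rightarrow>\<^sub>L real" and d :: "'i \<Rightarrow> real"
  assumes "finite S" "card S \<le> Suc n" "j \<in> S"
    and sep: "\<And>i. i \<in> S - {j} \<Longrightarrow> \<exists>x. \<phi> i x = 0 \<and> \<phi> j x \<noteq> 0"
    and nz: "\<phi> j \<noteq> 0"
    and zero: "\<And>w. 0 \<le> w \<Longrightarrow> (\<Sum>i\<in>S. d i * \<phi> i w ^ n) = 0"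
  shows "d j = 0"
  using assms(1-4) zero
proof (induction n arbitrary: S d)
  case 0
  then have "S = {j}"
    by (metis One_nat_def card_1_singletonE card_0_eq empty_iff le_Suc_eq le_zero_eq singletonD)
  then show ?case using "0.prems"(5)[of 0] by simp
next
  case (Suc n)
  \<comment> \<open>If \<open>j\<close> is already isolated, any point with \<open>\<phi> j x \<noteq> 0\<close> serves to lower the exponent.\<close>
  obtain x T where x: "\<phi> j x \<noteq> 0" and T: "T \<subseteq> S" "j \<in> T" "card T \<le> Suc n"
      "\<And>i. i \<in> S - T \<Longrightarrow> \<phi> i x = 0"
  proof (cases "S = {j}")
    case True
    obtain x where "\<phi> j x \<noteq> 0" using nz by (metis blinfun_eqI zero_blinfun.rep_eq)
    then show ?thesis using that[of x S] True by auto
  next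
    case False
    then obtain i where i: "i \<in> S - {j}" using Suc.prems by auto
    then obtain x where "\<phi> i x = 0" "\<phi> j x \<noteq> 0" using Suc.prems(4) by blast
    then show ?thesis
      using i Suc.prems(1-3) by (intro that[of x "S - {i}"]) auto
  qed
  have *: "(\<Sum>i\<in>S. d i * \<phi> i w ^ n * \<phi> i y) = 0" if "0 \<le> w" "0 \<le> y" for w y
  proof (rule linear_coeff_eq_0)
    fix t :: real assume "0 < t"
    then show "(\<Sum>i\<in>S. d i * (\<phi> i w + t * \<phi> i y) ^ Suc n) = 0"
      using Suc.prems(5)[of "w + t *\<^sub>R y"] that
      by (simp add: blinfun.add_right blinfun.scaleR_right scaleR_nonneg_nonneg)
  qed
  have "(\<Sum>i\<in>T. (d i * \<phi> i x) * \<phi> i w ^ n) = 0" if "0 \<le> w" for w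
  proof -
    have x_eq: "\<phi> i x = \<phi> i (sup x 0) - \<phi> i (sup (- x) 0)" for i
      by (simp only: pos_part_minus_neg_part flip: blinfun.diff_right)
    have "(\<Sum>i\<in>T. (d i * \<phi> i x) * \<phi> i w ^ n) = (\<Sum>i\<in>S. (d i * \<phi> i x) * \<phi> i w ^ n)"
      using T Suc.prems(1) by (intro sum.mono_neutral_left) auto
    also have "\<dots> = (\<Sum>i\<in>S. d i * \<phi> i w ^ n * \<phi> i (sup x 0))
        - (\<Sum>i\<in>S. d i * \<phi> i w ^ n * \<phi> i (sup (- x) 0))"
      by (simp add: x_eq algebra_simps flip: sum_subtractf)
    also have "\<dots> = 0"
      using *[OF that] by simp
    finally show ?thesis .
  qed
  moreover have "finite T" using T(1) Suc.prems(1) finite_subset by blast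
  moreover have "\<exists>x. \<phi> i x = 0 \<and> \<phi> j x \<noteq> 0" if "i \<in> T - {j}" for i
    using Suc.prems(4) that T(1) by blast
  ultimately have "d j * \<phi> j x = 0"
    using T by (intro Suc.IH[of T "\<lambda>i. d i * \<phi> i x"])
  then show ?case using x by simp
qed

text \<open>The form in which pairwise independence supplies the points that separate functionals above.\<close>

lemma not_multiple_imp_separated:
  fixes f g :: "'a::real_normed_vector \<Rightarrow>\<^sub>L real"
  assumes "\<And>r. g \<noteq> r *\<^sub>R f"
  shows "\<exists>x. f x = 0 \<and> g x \<noteq> 0"
proof (rule ccontr)
  assume *: "\<nexists>x. f x = 0 \<and> g x \<noteq> 0"
  have "f \<noteq> 0"
  proof
    assume "f = 0"
    then have "g = 0" using * by (intro blinfun_eqI) simp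
    then show False using assms[of 0] by simp
  qed
  then obtain e where e: "f e \<noteq> 0" by (metis blinfun_eqI zero_blinfun.rep_eq)
  have "g x = ((g e / f e) *\<^sub>R f) x" for x
  proof -
    have "f (x - (f x / f e) *\<^sub>R e) = 0"
      using e by (simp add: blinfun.diff_right blinfun.scaleR_right)
    then have "g (x - (f x / f e) *\<^sub>R e) = 0" using * by blast
    then show ?thesis by (simp add: blinfun.diff_right blinfun.scaleR_right blinfun.scaleR_left)
  qed
  then have "g = (g e / f e) *\<^sub>R f"
    by (rule blinfun_eqI)
  then show False using assms by blast
qed

section \<open>The characterisation\<close>

theorem theorem1:
  fixes k m :: nat
    and c :: "nat \<Rightarrow> real"
    and \<phi> :: "nat \<Rightarrow> ('a::banach_lattice \<Rightarrow>\<^sub>L real)"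
  assumes "0 < k" and "k < m"
    and "\<And>j. j \<in> {1..k} \<Longrightarrow> c j \<noteq> 0"
    and "\<And>i j r. i \<in> {1..k} \<Longrightarrow> j \<in> {1..k} \<Longrightarrow> i \<noteq> j \<Longrightarrow> \<phi> i \<noteq> r *\<^sub>R \<phi> j"
  shows "orthogonally_additive_polynomial m (\<lambda>x. \<Sum>j=1..k. c j * blinfun_apply (\<phi> j) x ^ m)
    \<longleftrightarrow> (\<forall>j\<in>{1..k}. lattice_homomorphism (\<phi> j) \<or> lattice_homomorphism (- \<phi> j))"
    (is "orthogonally_additive_polynomial m ?P \<longleftrightarrow> ?hom")
proof
  assume oa: "orthogonally_additive_polynomial m ?P"
  have add: "?P (u + v) = ?P u + ?P v" if "0 \<le> u" "0 \<le> v" "inf u v = 0" for u v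
  proof -
    have "inf \<bar>u\<bar> \<bar>v\<bar> = 0" using that by (simp only: abs_of_nonneg)
    then show ?thesis
      using oa unfolding orthogonally_additive_polynomial_def by blast
  qed
  show ?hom
  proof
    fix j assume j: "j \<in> {1..k}"
    have "\<phi> j u * \<phi> j v = 0" if uv: "0 \<le> u" "0 \<le> v" "inf u v = 0" for u v
    \<comment> \<open>For \<open>k = 1\<close> the single functional may be \<open>0\<close>; the product is then trivially \<open>0\<close>.\<close>
    proof (cases "\<phi> j = 0")
      case False
      have "c j * \<phi> j u * \<phi> j v = 0"
      proof (rule powers_independent_on_cone[where S = "{1..k}" and n = "m - 2" and \<phi> = \<phi>
            and d = "\<lambda>i. c i * \<phi> i u * \<phi> i v"])
        show "card {1..k} \<le> Suc (m - 2)" using assms by simp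
        show "\<exists>x. \<phi> i x = 0 \<and> \<phi> j x \<noteq> 0" if "i \<in> {1..k} - {j}" for i
          using that j assms(4) by (intro not_multiple_imp_separated) auto
        show "(\<Sum>i\<in>{1..k}. c i * \<phi> i u * \<phi> i v * \<phi> i w ^ (m - 2)) = 0" if "0 \<le> w" for w
        proof -
          have "(\<Sum>i\<in>{1..k}. c i * \<phi> i u ^ 1 * \<phi> i v ^ 1 * \<phi> i w ^ (m - 2)) = 0"
            by (rule mixed_sum_eq_0[OF add]) (use uv \<open>0 \<le> w\<close> assms(1,2) in auto)
          then show ?thesis by (simp only: power_one_right)
        qed
      qed (use j False in auto)
      then show ?thesis using assms(3)[OF j] by simp
    qed simp
    then show "lattice_homomorphism (\<phi> j) \<or> lattice_homomorphism (- \<phi> j)"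
      by (rule disjointness_preserving_functional_is_signed_homomorphism)
  qed
next
  assume hom: ?hom
  have "?P (x + y) = ?P x + ?P y" if "inf \<bar>x\<bar> \<bar>y\<bar> = 0" for x y
  proof -
    have "\<phi> j (x + y) ^ m = \<phi> j x ^ m + \<phi> j y ^ m" if "j \<in> {1..k}" for j
      using lattice_homomorphism_disjoint[of "\<phi> j" x y] hom that \<open>inf \<bar>x\<bar> \<bar>y\<bar> = 0\<close> assms
      by (auto simp: blinfun.add_right power_0_left)
    then show ?thesis by (simp add: distrib_left flip: sum.distrib)
  qed
  then show "orthogonally_additive_polynomial m ?P"
    using homogeneous_polynomial_sum_powers by (simp add: orthogonally_additive_polynomial_def)
qed

end
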